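(* Let $\mathcal{C}$ be a covariety and $S\in\mathcal{C}$. Then $\mathcal{C}_{\mathrm{rank}}(S)=0$ if and only if $S=\Delta(\mathcal{C})$.
   Context: Let $\mathbb{N}=\{0,1,2,\dots\}$. A numerical semigroup is a subset $S\subseteq\mathbb{N}$ that contains $0$, is closed under addition, and has finite complement $\mathbb{N}\setminus S$. Its multiplicity is $m(S)=\min(S\setminus\{0\})$. A covariety is a nonempty family $\mathcal{C}$ of numerical semigroups such that: (1) $\mathcal{C}$ has a minimum $\Delta(\mathcal{C})=\min(\mathcal{C})$ with respect to set inclusion; (2) if $S,T\in\mathcal{C}$ then $S\cap T\in\mathcal{C}$; (3) if $S\in\mathcal{C}$ and $S\neq\Delta(\mathcal{C})$ then $S\setminus\{m(S)\}\in\mathcal{C}$. A $\mathcal{C}$-set is a subset (possibly empty) of $M\setminus\Delta(\mathcal{C})$ for some maximal (with respect to inclusion) element $M$ of $\mathcal{C}$. For a $\mathcal{C}$-set $A$, $\mathcal{C}(A)$ is the intersection of all elements of $\mathcal{C}$ containing $A$ (it is the least element of $\mathcal{C}$ containing $A$). For $S\in\mathcal{C}$, the $\mathcal{C}$-rank of $S$ is $\mathcal{C}_{\mathrm{rank}}(S)=\min\{\sharp A\mid A\text{ is a }\mathcal{C}\text{-set and }\mathcal{C}(A)=S\}$, where $\sharp A$ denotes the cardinality of $A$. *)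

theory Defs
  imports Main
begin

definition numerical_semigroup :: "nat set \<Rightarrow> bool" where
  "numerical_semigroup S \<longleftrightarrow>
     0 \<in> S \<and> (\<forall>x\<in>S. \<forall>y\<in>S. x + y \<in> S) \<and> finite (UNIV - S)"

definition multiplicity :: "nat set \<Rightarrow> nat" where
  "multiplicity S = (LEAST x. x \<in> S - {0})"

text \<open>The least element of the family for set inclusion; meaningful only if one exists.\<close>

definition Delta :: "nat set set \<Rightarrow> nat set" where
  "Delta C = (LEAST S. S \<in> C)"

definition covariety :: "nat set set \<Rightarrow> bool" where
  "covariety C \<longleftrightarrow>
     C \<noteq> {} \<and>
     (\<forall>S\<in>C. numerical_semigroup S) \<and>
     (\<exists>D\<in>C. \<forall>S\<in>C. D \<subseteq> S) \<and>
     (\<forall>S\<in>C. \<forall>T\<in>C. S \<inter> T \<in> C) \<and>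
     (\<forall>S\<in>C. S \<noteq> Delta C \<longrightarrow> S - {multiplicity S} \<in> C)"

definition maximal_in :: "nat set set \<Rightarrow> nat set \<Rightarrow> bool" where
  "maximal_in C M \<longleftrightarrow> M \<in> C \<and> (\<forall>T\<in>C. M \<subseteq> T \<longrightarrow> T = M)"

definition C_set :: "nat set set \<Rightarrow> nat set \<Rightarrow> bool" where
  "C_set C A \<longleftrightarrow> (\<exists>M. maximal_in C M \<and> A \<subseteq> M - Delta C)"

definition C_generated :: "nat set set \<Rightarrow> nat set \<Rightarrow> nat set" where
  "C_generated C A = \<Inter>{T \<in> C. A \<subseteq> T}"

text \<open>For a covariety, every \<open>C\<close>-set is finite, because \<open>Delta C\<close> has finite complement;
  so \<open>card\<close> is the true cardinality here.\<close>

definition C_rank :: "nat set set \<Rightarrow> nat set \<Rightarrow> nat" where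
  "C_rank C S = (LEAST k. \<exists>A. C_set C A \<and> C_generated C A = S \<and> card A = k)"

end

theory Submission
  imports Defs
begin

text \<open>Every member of \<open>C\<close> contains \<open>Delta C\<close>, so the empty set
  generates exactly \<open>Delta C\<close>. Rank 0 therefore means being generated by the empty set,
  provided that the minimum defining the rank is attained and that cardinality 0 forces emptiness.
  \<open>C_rank_attained\<close> gives the former, with \<open>S - Delta C\<close> as a generating
  \<open>C\<close>-set; \<open>C_set_finite\<close> gives the latter.\<close>

lemma Delta_in_and_least:
  assumes "covariety C"
  shows "Delta C \<in> C \<and> (\<forall>S\<in>C. Delta C \<subseteq> S)"
proof -
  have "\<exists>D\<in>C. \<forall>S\<in>C. D \<subseteq> S"
    using assms by (simp add: covariety_def)
  then obtain D where D: "D \<in> C" "\<And>S. S \<in> C \<Longrightarrow> D \<subseteq> S" by blast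
  then have "Delta C = D"
    unfolding Delta_def by (intro Least_equality)
  with D show ?thesis by simp
qed

lemmas Delta_in = Delta_in_and_least[THEN conjunct1]
lemmas Delta_least = Delta_in_and_least[THEN conjunct2, rule_format]

text \<open>A member is determined by its part outside \<open>Delta C\<close>, a subset of a finite
  set. Finiteness is what places each member below a maximal one.\<close>

lemma covariety_finite:
  assumes "covariety C"
  shows "finite C"
proof -
  have "finite (- Delta C)"
    using assms Delta_in[OF assms]
    by (auto simp: covariety_def numerical_semigroup_def Compl_eq_Diff_UNIV)
  moreover have "C \<subseteq> (\<lambda>B. Delta C \<union> B) ` Pow (- Delta C)"
  proof
    fix S assume "S \<in> C"
    then have "S = Delta C \<union> (S - Delta C)"
      using Delta_least[OF assms] by blast
    then show "S \<in> (\<lambda>B. Delta C \<union> B) ` Pow (- Delta C)" by blast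
  qed
  ultimately show ?thesis by (simp add: finite_subset)
qed

lemma ex_maximal_superset:
  assumes "covariety C" and "S \<in> C"
  obtains M where "maximal_in C M" and "S \<subseteq> M"
proof -
  obtain M where "M \<in> C" "S \<subseteq> M" and "\<forall>T\<in>C. M \<subseteq> T \<longrightarrow> M = T"
    using finite_has_maximal2[OF covariety_finite[OF assms(1)] assms(2)] by (elim bexE conjE)
  then have "maximal_in C M" by (auto simp: maximal_in_def)
  then show ?thesis using \<open>S \<subseteq> M\<close> by (rule that)
qed

text \<open>Since \<open>card\<close> is 0 on infinite sets too, this is needed to conclude
  \<open>A = {}\<close> from \<open>card A = 0\<close>.\<close>

lemma C_set_finite:
  assumes "covariety C" and "C_set C A"
  shows "finite A"
proof -
  have "finite (UNIV - Delta C)"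
    using assms(1) Delta_in[OF assms(1)]
    by (auto simp: covariety_def numerical_semigroup_def)
  then show ?thesis
    using assms(2) unfolding C_set_def by (auto elim: finite_subset[rotated])
qed

lemma C_generated_empty:
  assumes "covariety C"
  shows "C_generated C {} = Delta C"
  using Delta_in[OF assms] Delta_least[OF assms] unfolding C_generated_def by blast

lemma C_set_Diff_Delta:
  assumes "covariety C" and "S \<in> C"
  shows "C_set C (S - Delta C)"
proof -
  obtain M where "maximal_in C M" "S \<subseteq> M"
    using ex_maximal_superset[OF assms] .
  then show ?thesis unfolding C_set_def by blast
qed

text \<open>As all members contain \<open>Delta C\<close>, those containing
  \<open>S - Delta C\<close> are those containing \<open>S\<close>, and \<open>S\<close> is the
  least of these.\<close>

lemma C_generated_Diff_Delta:
  assumes "covariety C" and "S \<in> C"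
  shows "C_generated C (S - Delta C) = S"
  using assms(2) Delta_least[OF assms(1)] unfolding C_generated_def by blast

text \<open>The \<open>LEAST\<close> in \<open>C_rank\<close> is meaningful only if some
  \<open>C\<close>-set generates \<open>S\<close>; \<open>S - Delta C\<close> does.\<close>

lemma C_rank_attained:
  assumes "covariety C" and "S \<in> C"
  obtains A where "C_set C A" and "C_generated C A = S" and "card A = C_rank C S"
proof -
  have "\<exists>A. C_set C A \<and> C_generated C A = S \<and> card A = C_rank C S"
    unfolding C_rank_def
    by (rule LeastI[where k = "card (S - Delta C)"])
       (use C_set_Diff_Delta[OF assms] C_generated_Diff_Delta[OF assms] in blast)
  then show ?thesis using that by blast
qed

theorem proposition6p2:
  fixes C :: "nat set set" and S :: "nat set"
  assumes "covariety C" and "S \<in> C"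
  shows "C_rank C S = 0 \<longleftrightarrow> S = Delta C"
proof
  assume "C_rank C S = 0"
  then obtain A where "C_set C A" "C_generated C A = S" "card A = 0"
    using C_rank_attained[OF assms] by metis
  then show "S = Delta C"
    using C_set_finite[OF assms(1)] C_generated_empty[OF assms(1)] by auto
next
  assume "S = Delta C"
  then have "C_set C {} \<and> C_generated C {} = S \<and> card ({} :: nat set) = 0"
    \<comment> \<open>With \<open>S = Delta C\<close>, the \<open>C\<close>-set
      \<open>S - Delta C\<close> is empty.\<close>
    using C_set_Diff_Delta[OF assms] C_generated_empty[OF assms(1)] by simp
  then show "C_rank C S = 0"
    unfolding C_rank_def by (intro Least_eq_0) blast
qed

end
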